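(* Let $n \ge 3$. For every non-absorbing state $M$ of the binary trust-gossip dynamics on $n$ agents, there exists a finite sequence of firing moves starting from $M$ that leads to an absorbing state.
   Context: Fix $n \ge 3$ agents. A state is a directed binary matrix $M$ with an entry $M_{ij} \in \{0,1\}$ for each ordered pair of distinct agents $(i,j)$; diagonal entries are undefined. Write $i(j)$ for $M_{ij}$, agent $i$'s opinion of agent $j$; "$i$ trusts $j$" means $i(j)=1$. Firing move: for distinct agents $a$ (speaker), $z$ (listener), $y$ (target) with $z(a)=1$ and $z(y) \ne a(y)$ in the current state, the move sets $z(y) := a(y)$ and changes no other entry. A state is absorbing if no firing move is available in it, i.e. for every triple $(a,z,y)$ of distinct agents, $z(a)=0$ or $z(y)=a(y)$. *)

theory Defs
  imports Main "HOL-Library.FuncSet"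
begin

text \<open>
  The set of agents is \<open>A\<close>, and \<open>M (i, j)\<close> is agent \<open>i\<close>'s opinion of agent \<open>j\<close>.
  States are extensional functions, so the diagonal entries all have the value
  \<^const>\<open>undefined\<close>, and two states are equal iff their off-diagonal entries agree.
\<close>

definition agent_pairs :: "'a set \<Rightarrow> ('a \<times> 'a) set" where
  "agent_pairs A = {(i, j). i \<in> A \<and> j \<in> A \<and> i \<noteq> j}"

definition states :: "'a set \<Rightarrow> ('a \<times> 'a \<Rightarrow> nat) set" where
  "states A = agent_pairs A \<rightarrow>\<^sub>E {0, 1}"

text \<open>The agents \<open>a\<close>, \<open>z\<close>, \<open>y\<close> are the speaker, the listener and the target.\<close>

definition can_fire :: "'a set \<Rightarrow> ('a \<times> 'a \<Rightarrow> nat) \<Rightarrow> 'a \<Rightarrow> 'a \<Rightarrow> 'a \<Rightarrow> bool" where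
  "can_fire A M a z y \<longleftrightarrow>
     a \<in> A \<and> z \<in> A \<and> y \<in> A \<and> a \<noteq> z \<and> a \<noteq> y \<and> z \<noteq> y \<and>
     M (z, a) = 1 \<and> M (z, y) \<noteq> M (a, y)"

definition fire :: "('a \<times> 'a \<Rightarrow> nat) \<Rightarrow> 'a \<Rightarrow> 'a \<Rightarrow> 'a \<Rightarrow> ('a \<times> 'a \<Rightarrow> nat)" where
  "fire M a z y = M((z, y) := M (a, y))"

definition firing_move :: "'a set \<Rightarrow> ('a \<times> 'a \<Rightarrow> nat) \<Rightarrow> ('a \<times> 'a \<Rightarrow> nat) \<Rightarrow> bool" where
  "firing_move A M M' \<longleftrightarrow> (\<exists>a z y. can_fire A M a z y \<and> M' = fire M a z y)"

definition absorbing :: "'a set \<Rightarrow> ('a \<times> 'a \<Rightarrow> nat) \<Rightarrow> bool" where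
  "absorbing A M \<longleftrightarrow> \<not> (\<exists>a z y. can_fire A M a z y)"

lemma firing_move_in_states:
  assumes "M \<in> states A" and "firing_move A M M'"
  shows "M' \<in> states A"
  using assms
  by (fastforce simp: states_def agent_pairs_def firing_move_def can_fire_def fire_def
      PiE_iff extensional_def)

lemma absorbing_iff:
  assumes "M \<in> states A"
  shows "absorbing A M \<longleftrightarrow>
    (\<forall>a\<in>A. \<forall>z\<in>A. \<forall>y\<in>A. a \<noteq> z \<and> a \<noteq> y \<and> z \<noteq> y \<longrightarrow>
       M (z, a) = 0 \<or> M (z, y) = M (a, y))"
proof -
  have "M (z, a) = 0 \<longleftrightarrow> M (z, a) \<noteq> 1" if "a \<in> A" "z \<in> A" "a \<noteq> z" for a z
    using assms that by (fastforce simp: states_def agent_pairs_def PiE_iff)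
  then show ?thesis
    unfolding absorbing_def can_fire_def by blast
qed

end

theory Submission
  imports Defs
begin

text \<open>
  Read \<open>M (i, j) = 1\<close> as an arc from \<open>i\<close> to \<open>j\<close>. A firing move either adds an arc that closes
  a path of length two (the speaker trusts the target), or deletes an arc \<open>z \<rightarrow> y\<close> while \<open>z\<close> keeps
  an arc to some \<open>a\<close> without an arc to \<open>y\<close>. The two kinds can undo each other, so an arbitrary
  run need not stop; the proof schedules them in two phases, each with its own bounded measure.

  Adding arcs alone must end, and it ends in a transitive state: among the reachable
  states, one with the most arcs is transitive (\<open>reaches_transitive\<close>).

  In a transitive state only deletions can fire. A single deletion may destroy transitivity, but
  if \<open>z\<close> trusts \<open>a\<close> and adopts all of \<open>a\<close>'s opinions in one go, the state stays transitive
  (\<open>transitive_adopt\<close>), and no arc is created (\<open>trust_arcs_adopt_subset\<close>). Hence a reachable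
  transitive state with the fewest arcs is absorbing, since any available move could be extended
  to such an adoption, with a strictly smaller set of arcs.
\<close>

definition trust_arcs :: "'a set \<Rightarrow> ('a \<times> 'a \<Rightarrow> nat) \<Rightarrow> ('a \<times> 'a) set" where
  "trust_arcs A M = {p \<in> agent_pairs A. M p = 1}"

text \<open>
  Endpoints \<open>x = z\<close> are excluded because states have no diagonal, so this is transitivity of the
  reflexive closure of trust.
\<close>

definition transitive_state :: "'a set \<Rightarrow> ('a \<times> 'a \<Rightarrow> nat) \<Rightarrow> bool" where
  "transitive_state A M \<longleftrightarrow>
     (\<forall>x\<in>A. \<forall>y\<in>A. \<forall>z\<in>A. x \<noteq> y \<longrightarrow> y \<noteq> z \<longrightarrow> x \<noteq> z \<longrightarrow>
        M (x, y) = 1 \<longrightarrow> M (y, z) = 1 \<longrightarrow> M (x, z) = 1)"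

lemma transitive_stateD:
  assumes "transitive_state A M" "M (x, y) = 1" "M (y, z) = 1"
    and "x \<in> A" "y \<in> A" "z \<in> A" "x \<noteq> y" "y \<noteq> z" "x \<noteq> z"
  shows "M (x, z) = 1"
  using assms unfolding transitive_state_def by blast

definition adopt :: "('a \<times> 'a \<Rightarrow> nat) \<Rightarrow> 'a \<Rightarrow> 'a \<Rightarrow> 'a set \<Rightarrow> ('a \<times> 'a \<Rightarrow> nat)" where
  "adopt M a z B = (\<lambda>(i, j). if i = z \<and> j \<in> B then M (a, j) else M (i, j))"

lemma state_value:
  assumes "M \<in> states A" "i \<in> A" "j \<in> A" "i \<noteq> j"
  shows "M (i, j) = 0 \<or> M (i, j) = 1"
  using assms by (fastforce simp: states_def agent_pairs_def PiE_iff)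

lemma finite_agent_pairs: "finite A \<Longrightarrow> finite (agent_pairs A)"
  by (rule finite_subset[of _ "A \<times> A"]) (auto simp: agent_pairs_def)

lemma finite_trust_arcs: "finite A \<Longrightarrow> finite (trust_arcs A M)"
  by (simp add: trust_arcs_def finite_agent_pairs)

lemma firing_moves_in_states:
  assumes "(firing_move A)\<^sup>*\<^sup>* M M'" "M \<in> states A"
  shows "M' \<in> states A"
  using assms by (induction rule: rtranclp_induct) (auto intro: firing_move_in_states)

lemma fire_adds_arc:
  assumes "can_fire A M a z y" "M (a, y) = 1"
  shows "trust_arcs A (fire M a z y) = insert (z, y) (trust_arcs A M)"
    and "(z, y) \<notin> trust_arcs A M"
  using assms by (auto simp: trust_arcs_def can_fire_def fire_def agent_pairs_def)

text \<open>
  A state with the most arcs among the reachable ones is transitive: wherever transitivity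
  fails, the middle agent can persuade the first one to trust the last.
\<close>

lemma reaches_transitive:
  assumes "finite A"
  obtains M' where "(firing_move A)\<^sup>*\<^sup>* M M'" "transitive_state A M'"
proof -
  have "\<exists>M'. (firing_move A)\<^sup>*\<^sup>* M M' \<and>
      (\<forall>N. (firing_move A)\<^sup>*\<^sup>* M N \<longrightarrow> card (trust_arcs A N) \<le> card (trust_arcs A M'))"
  proof (rule Lattices_Big.ex_has_greatest_nat)
    show "(firing_move A)\<^sup>*\<^sup>* M M" by simp
    show "\<forall>N. (firing_move A)\<^sup>*\<^sup>* M N \<longrightarrow> card (trust_arcs A N) < Suc (card (agent_pairs A))"
      by (auto simp: trust_arcs_def less_Suc_eq_le intro!: card_mono finite_agent_pairs assms)
  qed
  then obtain M' where reach: "(firing_move A)\<^sup>*\<^sup>* M M'"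
    and most: "\<And>N. (firing_move A)\<^sup>*\<^sup>* M N \<Longrightarrow> card (trust_arcs A N) \<le> card (trust_arcs A M')"
    by blast
  have "transitive_state A M'"
  proof (rule ccontr)
    assume "\<not> transitive_state A M'"
    then obtain z a y where fires: "can_fire A M' a z y" and "M' (a, y) = 1"
      unfolding transitive_state_def can_fire_def by metis
    note arcs = fire_adds_arc[OF this]
    have "(firing_move A)\<^sup>*\<^sup>* M (fire M' a z y)"
      using reach fires unfolding firing_move_def by (blast intro: rtranclp.rtrancl_into_rtrancl)
    from most[OF this] show False
      using arcs finite_trust_arcs[OF assms] by simp
  qed
  with reach show thesis by (rule that)
qed

text \<open>
  The entry \<open>(z, a)\<close> is never overwritten, so \<open>z\<close> still trusts \<open>a\<close> after each copied
  entry and can go on copying.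
\<close>

lemma firing_moves_adopt:
  assumes "finite B" "B \<subseteq> A - {a, z}" "a \<in> A" "z \<in> A" "a \<noteq> z" "M (z, a) = 1"
  shows "(firing_move A)\<^sup>*\<^sup>* M (adopt M a z B)"
  using assms(1,2)
proof (induction B rule: finite_induct)
  case empty
  show ?case by (simp add: adopt_def)
next
  case (insert y B)
  let ?N = "adopt M a z B"
  have step: "adopt M a z (insert y B) = fire ?N a z y"
    using assms(5) by (auto simp: adopt_def fire_def)
  have "fire ?N a z y = ?N \<or> firing_move A ?N (fire ?N a z y)"
  proof (cases "?N (z, y) = ?N (a, y)")
    case True
    then show ?thesis by (metis fire_def fun_upd_triv)
  next
    case False
    moreover have "?N (z, a) = 1" using insert.prems assms(6) by (auto simp: adopt_def)
    ultimately show ?thesis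
      using insert.prems assms(3-5) unfolding firing_move_def can_fire_def by blast
  qed
  with insert step show ?case
    by (metis insert_subset rtranclp.rtrancl_into_rtrancl)
qed

text \<open>
  In a transitive state \<open>z\<close> already trusts everyone else that \<open>a\<close> trusts, so adopting \<open>a\<close>'s
  opinions can only delete arcs.
\<close>

lemma trust_arcs_adopt_subset:
  assumes "transitive_state A M" "a \<in> A" "z \<in> A" "a \<noteq> z" "M (z, a) = 1" "B \<subseteq> A - {a, z}"
  shows "trust_arcs A (adopt M a z B) \<subseteq> trust_arcs A M"
proof
  fix p
  assume "p \<in> trust_arcs A (adopt M a z B)"
  then obtain i j where p: "p = (i, j)" and mem: "i \<in> A" "j \<in> A" "i \<noteq> j"
    and arc: "adopt M a z B (i, j) = 1"
    by (auto simp: trust_arcs_def agent_pairs_def)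
  have "M (i, j) = 1"
  proof (cases "i = z \<and> j \<in> B")
    case True
    then have "M (a, j) = 1" "j \<noteq> a" using arc assms(6) by (auto simp: adopt_def)
    then show ?thesis using transitive_stateD[OF assms(1,5)] assms(2-4) mem True by simp
  next
    case False
    then show ?thesis using arc by (simp add: adopt_def split: if_splits)
  qed
  then show "p \<in> trust_arcs A M" using p mem by (simp add: trust_arcs_def agent_pairs_def)
qed

text \<open>
  After the adoption \<open>z\<close> trusts exactly \<open>a\<close> and the agents other than \<open>z\<close> that \<open>a\<close> trusts, a set
  that already absorbs whatever its members trust. Paths through \<open>z\<close> are harmless because \<open>z\<close>'s
  arcs have only been deleted. Copying only some of the opinions would not do: if \<open>z\<close> gives up
  \<open>y\<close> but keeps an agent who trusts \<open>y\<close>, transitivity is lost.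
\<close>

lemma transitive_adopt:
  assumes trans: "transitive_state A M"
    and "a \<in> A" "z \<in> A" "a \<noteq> z" "M (z, a) = 1"
  shows "transitive_state A (adopt M a z (A - {a, z}))" (is "transitive_state A ?N")
  unfolding transitive_state_def
proof (intro ballI impI)
  fix u v w
  assume mem: "u \<in> A" "v \<in> A" "w \<in> A" and dist: "u \<noteq> v" "v \<noteq> w" "u \<noteq> w"
    and arcs: "?N (u, v) = 1" "?N (v, w) = 1"
  have "trust_arcs A ?N \<subseteq> trust_arcs A M"
    using assms by (intro trust_arcs_adopt_subset) auto
  with mem dist arcs have old: "M (u, v) = 1" "M (v, w) = 1"
    by (auto simp: trust_arcs_def agent_pairs_def)
  show "?N (u, w) = 1"
  proof (cases "u = z")
    case False
    then show ?thesis using transitive_stateD[OF trans old] mem dist by (simp add: adopt_def)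
  next
    case z: True
    show ?thesis
    proof (cases "w = a")
      case True
      then show ?thesis using z assms(5) by (simp add: adopt_def)
    next
      case False
      have "M (a, w) = 1"
      proof (cases "v = a")
        case True
        then show ?thesis using old by simp
      next
        case False
        then have "M (a, v) = 1" using arcs(1) z mem dist by (simp add: adopt_def)
        then show ?thesis
          using transitive_stateD[OF trans _ old(2), of a] mem dist \<open>v \<noteq> a\<close> \<open>w \<noteq> a\<close> \<open>a \<in> A\<close>
          by simp
      qed
      then show ?thesis using z False mem dist by (simp add: adopt_def)
    qed
  qed
qed

theorem corollary3:
  fixes A :: "'a set" and n :: nat and M :: "'a \<times> 'a \<Rightarrow> nat"
  assumes "n \<ge> 3" and "finite A" and "card A = n"
    and "M \<in> states A" and "\<not> absorbing A M"
  shows "\<exists>M' \<in> states A. (firing_move A)\<^sup>*\<^sup>* M M' \<and> absorbing A M'"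
proof -
  let ?reach = "\<lambda>N. (firing_move A)\<^sup>*\<^sup>* M N \<and> transitive_state A N"
  obtain T where T: "(firing_move A)\<^sup>*\<^sup>* M T" "transitive_state A T"
    by (rule reaches_transitive[OF assms(2)])
  have "\<exists>M'. ?reach M' \<and> (\<forall>N. ?reach N \<longrightarrow> card (trust_arcs A M') \<le> card (trust_arcs A N))"
    by (rule ex_has_least_nat[where P = ?reach and k = T]) (intro conjI T)
  then obtain M' where reach: "(firing_move A)\<^sup>*\<^sup>* M M'" and trans: "transitive_state A M'"
    and fewest: "\<forall>N. ?reach N \<longrightarrow> card (trust_arcs A M') \<le> card (trust_arcs A N)"
    by (elim exE conjE) (rule that)
  have state: "M' \<in> states A"
    using reach assms(4) by (rule firing_moves_in_states)
  have "absorbing A M'"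
  proof (rule ccontr)
    assume "\<not> absorbing A M'"
    then obtain a z y where "can_fire A M' a z y"
      by (auto simp: absorbing_def)
    then have mem: "a \<in> A" "z \<in> A" "y \<in> A" and dist: "a \<noteq> z" "a \<noteq> y" "z \<noteq> y"
      and trust: "M' (z, a) = 1" and differ: "M' (z, y) \<noteq> M' (a, y)"
      by (auto simp: can_fire_def)
    \<comment> \<open>Transitivity rules out that the available move adds an arc.\<close>
    have "M' (z, y) = 1" if "M' (a, y) = 1"
      using transitive_stateD[OF trans trust that] mem dist by simp
    moreover have "M' (a, y) = 0 \<or> M' (a, y) = 1"
      by (rule state_value[OF state \<open>a \<in> A\<close> \<open>y \<in> A\<close> \<open>a \<noteq> y\<close>])
    moreover have "M' (z, y) = 0 \<or> M' (z, y) = 1"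
      by (rule state_value[OF state \<open>z \<in> A\<close> \<open>y \<in> A\<close> \<open>z \<noteq> y\<close>])
    ultimately have deleted: "M' (a, y) = 0" "M' (z, y) = 1"
      using differ by metis+
    let ?N = "adopt M' a z (A - {a, z})"
    have "(firing_move A)\<^sup>*\<^sup>* M' ?N"
      using assms(2) mem dist trust by (intro firing_moves_adopt) auto
    with reach have "(firing_move A)\<^sup>*\<^sup>* M ?N" by (rule rtranclp_trans)
    moreover have "transitive_state A ?N"
      using trans mem dist trust by (intro transitive_adopt) auto
    ultimately have "?reach ?N" by (rule conjI)
    have "trust_arcs A ?N \<subset> trust_arcs A M'"
    proof (rule psubsetI)
      show "trust_arcs A ?N \<subseteq> trust_arcs A M'"
        using trans mem dist trust by (intro trust_arcs_adopt_subset) auto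
      have "(z, y) \<in> trust_arcs A M'" "(z, y) \<notin> trust_arcs A ?N"
        using deleted mem dist by (auto simp: trust_arcs_def agent_pairs_def adopt_def)
      then show "trust_arcs A ?N \<noteq> trust_arcs A M'" by blast
    qed
    then have "card (trust_arcs A ?N) < card (trust_arcs A M')"
      by (rule psubset_card_mono[OF finite_trust_arcs[OF assms(2)]])
    moreover have "card (trust_arcs A M') \<le> card (trust_arcs A ?N)"
      by (rule fewest[rule_format, OF \<open>?reach ?N\<close>])
    ultimately show False by simp
  qed
  with state reach show ?thesis by (intro bexI conjI)
qed

end
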